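(* The updated posterior distribution of $\Lambda$ at time $t$, given the realized deterioration level $Y_t=y$ and an employed production policy $\bm{s}_t=\{s_u\}_{u\in[0,t)}$ up to time $t$, is a Gamma distribution with parameters $\alpha_0+y$ and $\beta_0+\int_0^t f(s_u)\,du$; that is, $$\Lambda\sim\Gamma\Big(\alpha_0+y,\ \beta_0+\int_0^t f(s_u)\,du\Big).$$
   Context: A newly installed system has an unknown base rate that is a realization of a random variable $\Lambda$ with Gamma prior of known shape $\alpha_0>0$ and rate $\beta_0>0$, i.e. with density $\varphi_0(\lambda\mid\alpha_0,\beta_0)=\beta_0^{\alpha_0}\lambda^{\alpha_0-1}e^{-\beta_0\lambda}/\Gamma(\alpha_0)$, $\lambda>0$. $\Gamma(\alpha,\beta)$ denotes the Gamma distribution with shape $\alpha$ and rate $\beta$. Here time runs forward from installation at time $0$. The decision maker uses production rate $s_u\in\mathscr{S}=[0,\bar s]$ ($0<\bar s<\infty$) at time $u$. The deterioration function $f:\mathscr{S}\to\mathbb{R}_+$ is continuous and (weakly) increasing with $f(0)=0$. Given $\Lambda=\lambda$ and the policy $\bm{s}_t$, the deterioration process $(Y_u)_{u\ge0}$, $Y_0=0$, is a non-homogeneous Poisson process with rate $\lambda f(s_u)$ at time $u$, so that $Y_t$ is Poisson distributed with mean $\lambda\int_0^t f(s_u)\,du$. *)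

theory Defs
  imports "HOL-Probability.Probability"
begin

text \<open>Gamma distribution in the shape/rate parametrisation, as a Borel measure on the reals.\<close>

definition gamma_density :: "real \<Rightarrow> real \<Rightarrow> real \<Rightarrow> real" where
  "gamma_density \<alpha> \<beta> x =
     (if x > 0 then \<beta> powr \<alpha> * x powr (\<alpha> - 1) * exp (- \<beta> * x) / Gamma \<alpha> else 0)"

definition gamma_distribution :: "real \<Rightarrow> real \<Rightarrow> real measure" where
  "gamma_distribution \<alpha> \<beta> = density lborel (\<lambda>x. ennreal (gamma_density \<alpha> \<beta> x))"

text \<open>\<open>\<kappa> x\<close> is a version of the conditional law of \<open>Z\<close> given \<open>X = x\<close>, as a probability kernel.
  With \<open>Z\<close> the identity it is a regular conditional probability on the underlying space.\<close>

definition regular_cond_distr ::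
  "'a measure \<Rightarrow> 'b measure \<Rightarrow> ('a \<Rightarrow> 'b) \<Rightarrow> 'c measure \<Rightarrow> ('a \<Rightarrow> 'c) \<Rightarrow> ('b \<Rightarrow> 'c measure) \<Rightarrow> bool"
  where
  "regular_cond_distr M MX X MZ Z \<kappa> \<longleftrightarrow>
     X \<in> M \<rightarrow>\<^sub>M MX \<and> Z \<in> M \<rightarrow>\<^sub>M MZ \<and> \<kappa> \<in> MX \<rightarrow>\<^sub>M prob_algebra MZ \<and>
     (\<forall>A\<in>sets MX. \<forall>B\<in>sets MZ.
        emeasure M {\<omega> \<in> space M. X \<omega> \<in> A \<and> Z \<omega> \<in> B} =
        (\<integral>\<^sup>+x\<in>A. emeasure (\<kappa> x) B \<partial>distr M MX X))"

text \<open>\<open>poisson_pmf\<close> is only specified for positive rates; a Poisson variable with mean 0 is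
  constantly 0.\<close>

definition poisson_law :: "real \<Rightarrow> nat pmf" where
  "poisson_law m = (if m = 0 then return_pmf 0 else poisson_pmf m)"

text \<open>Counting process on the time set \<open>I\<close> (an interval starting at 0) with
  intensity \<open>r\<close>. Paths are almost surely nondecreasing, so the truncated subtraction
  on the naturals is the true increment. The intensity is only
  constrained on the intervals \<open>[a, b)\<close> with \<open>a, b \<in> I\<close>, so for \<open>I = [0, t]\<close> its value at
  \<open>t\<close> is immaterial.\<close>

definition nonhomogeneous_poisson_process ::
  "'a measure \<Rightarrow> real set \<Rightarrow> (real \<Rightarrow> 'a \<Rightarrow> nat) \<Rightarrow> (real \<Rightarrow> real) \<Rightarrow> bool" where
  "nonhomogeneous_poisson_process P I N r \<longleftrightarrow>
     prob_space P \<and>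
     (\<forall>u\<in>I. N u \<in> P \<rightarrow>\<^sub>M count_space UNIV) \<and>
     (AE \<omega> in P. N 0 \<omega> = 0) \<and>
     (AE \<omega> in P. mono_on I (\<lambda>u. N u \<omega>) \<and>
        (\<forall>u\<in>I. continuous (at u within I \<inter> {u..}) (\<lambda>v. N v \<omega>))) \<and>
     (\<forall>n. \<forall>\<tau>::nat \<Rightarrow> real. \<tau> ` {..n} \<subseteq> I \<longrightarrow> mono_on {..n} \<tau> \<longrightarrow>
        prob_space.indep_vars P (\<lambda>_. count_space UNIV)
          (\<lambda>i \<omega>. N (\<tau> (Suc i)) \<omega> - N (\<tau> i) \<omega>) {..<n}) \<and>
     (\<forall>a\<in>I. \<forall>b\<in>I. a \<le> b \<longrightarrow>
        set_integrable lborel {a..<b} r \<and> (\<forall>u\<in>{a..<b}. 0 \<le> r u) \<and>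
        distr P (count_space UNIV) (\<lambda>\<omega>. N b \<omega> - N a \<omega>) =
          measure_pmf (poisson_law (LBINT u:{a..<b}. r u)))"

end

theory Submission
  imports Defs
begin

text \<open>Conjugacy: as a function of the rate, the Poisson likelihood of \<open>Y\<^sub>t = y\<close> times the prior
  Gamma density is a constant multiple of the posterior Gamma density. So the joint law of
  \<open>Y\<^sub>t\<close> and \<open>\<Lambda>\<close> charges \<open>{y} \<times> A\<close> with a constant times the posterior mass of \<open>A\<close>, and taking
  \<open>A\<close> to be the whole line identifies the constant as the probability of \<open>Y\<^sub>t = y\<close>.\<close>

lemma gamma_density_nonneg: "\<alpha> > 0 \<Longrightarrow> gamma_density \<alpha> \<beta> x \<ge> 0"
  by (simp add: gamma_density_def Gamma_real_nonneg)

lemma borel_measurable_gamma_density [measurable]: "gamma_density \<alpha> \<beta> \<in> borel_measurable borel"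
  unfolding gamma_density_def by measurable

lemma sets_gamma_distribution [measurable_cong]: "sets (gamma_distribution \<alpha> \<beta>) = sets borel"
  by (simp add: gamma_distribution_def)

text \<open>Rescaling x to x / \<beta> reduces the total mass to Euler's integral for
  \<open>Gamma \<alpha>\<close>, which the normalising constant cancels.\<close>

lemma prob_space_gamma_distribution:
  assumes "\<alpha> > 0" "\<beta> > 0"
  shows "prob_space (gamma_distribution \<alpha> \<beta>)"
proof
  have \<Gamma>: "Gamma \<alpha> > 0"
    using assms by (simp add: Gamma_real_pos)
  have "(\<integral>\<^sup>+x. ennreal (gamma_density \<alpha> \<beta> x) \<partial>lborel)
      = ennreal (1 / \<beta>) * (\<integral>\<^sup>+x. ennreal (gamma_density \<alpha> \<beta> (x / \<beta>)) \<partial>lborel)"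
    using assms
    by (subst nn_integral_real_affine[where t = 0 and c = "1 / \<beta>"]) (auto simp: mult.commute)
  also have "\<dots> = (\<integral>\<^sup>+x. ennreal (1 / \<beta>) * ennreal (gamma_density \<alpha> \<beta> (x / \<beta>)) \<partial>lborel)"
    by (subst nn_integral_cmult) auto
  also have "\<dots> = (\<integral>\<^sup>+x. ennreal (1 / Gamma \<alpha>) *
                    ennreal (indicator {0..} x * x powr (\<alpha> - 1) / exp x) \<partial>lborel)"
  proof (rule nn_integral_cong)
    fix x :: real
    \<comment> \<open>At x = 0 the closed half-line in the indicator does no harm:
      \<open>gamma_density\<close> is 0 there by definition, and so is
      \<open>0 powr (\<alpha> - 1)\<close>.\<close>
    have "1 / \<beta> * gamma_density \<alpha> \<beta> (x / \<beta>)
        = 1 / Gamma \<alpha> * (indicator {0..} x * x powr (\<alpha> - 1) / exp x)"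
      using assms \<Gamma>
      by (auto simp: gamma_density_def indicator_def powr_divide powr_diff exp_minus field_simps
          zero_less_divide_iff)
    thus "ennreal (1 / \<beta>) * ennreal (gamma_density \<alpha> \<beta> (x / \<beta>))
        = ennreal (1 / Gamma \<alpha>) * ennreal (indicator {0..} x * x powr (\<alpha> - 1) / exp x)"
      using assms \<Gamma> by (simp flip: ennreal_mult' add: gamma_density_nonneg)
  qed
  also have "\<dots> = ennreal (1 / Gamma \<alpha>) * ennreal (Gamma \<alpha>)"
    using assms by (subst nn_integral_cmult) (auto simp: Gamma_conv_nn_integral_real)
  also have "\<dots> = 1"
    using \<Gamma> by (simp flip: ennreal_mult')
  finally show "emeasure (gamma_distribution \<alpha> \<beta>) (space (gamma_distribution \<alpha> \<beta>)) = 1"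
    by (simp add: gamma_distribution_def emeasure_density)
qed

text \<open>One formula covers both branches of \<open>poisson_law\<close>, because
  \<open>0 ^ 0 = 1\<close> turns the case m = 0 into the point mass at 0. A vanishing cumulative
  intensity then needs no separate treatment.\<close>

lemma pmf_poisson_law: "m \<ge> 0 \<Longrightarrow> pmf (poisson_law m) k = m ^ k / fact k * exp (- m)"
  by (cases k) (auto simp: poisson_law_def pmf_return)

text \<open>The powers of x and the exponentials of likelihood and prior merge into those of the
  posterior density, and what remains is free of x. This remainder is the negative binomial
  probability of y with shape \<alpha> and success probability \<beta> / (\<beta> + F). For x \<le>
  0 both densities vanish, so nothing is asked of \<open>poisson_law\<close> at a negative
  mean.\<close>

lemma poisson_gamma_conjugate:
  assumes "\<alpha> > 0" "\<beta> > 0" "F \<ge> 0"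
  shows "gamma_density \<alpha> \<beta> x * pmf (poisson_law (x * F)) y =
         \<beta> powr \<alpha> * F ^ y * Gamma (\<alpha> + real y) /
           (fact y * Gamma \<alpha> * (\<beta> + F) powr (\<alpha> + real y)) *
         gamma_density (\<alpha> + real y) (\<beta> + F) x"
proof (cases "x > 0")
  case True
  have nz: "Gamma \<alpha> > 0" "Gamma (\<alpha> + real y) > 0" "(\<beta> + F) powr (\<alpha> + real y) > 0"
    using assms by (auto simp: Gamma_real_pos)
  have "x powr (\<alpha> + real y - 1) = x powr (\<alpha> - 1) * x ^ y"
    using True by (simp add: powr_add powr_diff powr_realpow)
  moreover have "exp (- (\<beta> + F) * x) = exp (- \<beta> * x) * exp (- (x * F))"
    by (simp flip: exp_add add: algebra_simps)
  moreover have "pmf (poisson_law (x * F)) y = x ^ y * F ^ y / fact y * exp (- (x * F))"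
    using True assms by (simp add: pmf_poisson_law power_mult_distrib)
  ultimately show ?thesis
    using True nz by (simp add: gamma_density_def mult_ac)
qed (simp add: gamma_density_def)

text \<open>On a countable discrete space measurability of a kernel is automatic, and every event
  about \<open>X\<close> is a countable disjoint union of events \<open>X \<omega> = x\<close>. The
  defining identity therefore only has to be checked on atoms, where it is the elementary product
  rule.\<close>

lemma regular_cond_distr_countableI:
  fixes X :: "'a \<Rightarrow> 'b::countable"
  assumes [measurable]: "X \<in> M \<rightarrow>\<^sub>M count_space UNIV" "Z \<in> M \<rightarrow>\<^sub>M N"
    and \<kappa>: "\<And>x. prob_space (\<kappa> x)" "\<And>x. sets (\<kappa> x) = sets N"
    and atom: "\<And>x B. B \<in> sets N \<Longrightarrow> emeasure M {\<omega> \<in> space M. X \<omega> = x \<and> Z \<omega> \<in> B} =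
      emeasure M {\<omega> \<in> space M. X \<omega> = x} * emeasure (\<kappa> x) B"
  shows "regular_cond_distr M (count_space UNIV) X N Z \<kappa>"
  unfolding regular_cond_distr_def
proof (intro conjI ballI)
  show "\<kappa> \<in> count_space UNIV \<rightarrow>\<^sub>M prob_algebra N"
    using \<kappa> by (simp add: measurable_count_space_eq1 space_prob_algebra)
next
  fix A :: "'b set" and B
  assume B [measurable]: "B \<in> sets N"
  \<comment> \<open>With the law of \<open>X\<close> written as a density against counting measure,
    the integral in the goal becomes a sum of kernel values weighted by atom probabilities.\<close>
  have distr_X: "distr M (count_space UNIV) X =
      density (count_space UNIV) (\<lambda>x. emeasure M {\<omega> \<in> space M. X \<omega> = x})"
  proof (rule measure_eqI_countable[where A = UNIV])
    fix x
    have "X -` {x} \<inter> space M = {\<omega> \<in> space M. X \<omega> = x}"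
      by auto
    thus "emeasure (distr M (count_space UNIV) X) {x} =
        emeasure (density (count_space UNIV) (\<lambda>x. emeasure M {\<omega> \<in> space M. X \<omega> = x})) {x}"
      by (simp add: emeasure_distr emeasure_density flip: nn_integral_count_space_indicator)
  qed simp_all
  have "{\<omega> \<in> space M. X \<omega> \<in> A \<and> Z \<omega> \<in> B} =
      (\<Union>x\<in>A. {\<omega> \<in> space M. X \<omega> = x \<and> Z \<omega> \<in> B})"
    by auto
  also have "emeasure M \<dots> =
      (\<integral>\<^sup>+x. emeasure M {\<omega> \<in> space M. X \<omega> = x \<and> Z \<omega> \<in> B} \<partial>count_space A)"
    by (rule emeasure_UN_countable) (auto simp: disjoint_family_on_def)
  also have "\<dots> = (\<integral>\<^sup>+x\<in>A. emeasure (\<kappa> x) B \<partial>distr M (count_space UNIV) X)"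
    by (simp add: distr_X nn_integral_density nn_integral_count_space_indicator atom B mult.assoc)
  finally show "emeasure M {\<omega> \<in> space M. X \<omega> \<in> A \<and> Z \<omega> \<in> B} =
      (\<integral>\<^sup>+x\<in>A. emeasure (\<kappa> x) B \<partial>distr M (count_space UNIV) X)" .
qed simp_all

text \<open>The process is specified through the laws of its increments, and it starts at 0 only
  almost surely. Hence \<open>N t\<close> is replaced by the increment over the whole interval,
  which agrees with it almost everywhere.\<close>

lemma distr_nonhomogeneous_poisson_process:
  assumes N: "nonhomogeneous_poisson_process P {0..t} N r" and "t \<ge> 0"
  shows "distr P (count_space UNIV) (N t) = measure_pmf (poisson_law (LBINT u:{0..<t}. r u))"
proof -
  have [measurable]: "N 0 \<in> P \<rightarrow>\<^sub>M count_space UNIV" "N t \<in> P \<rightarrow>\<^sub>M count_space UNIV"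
    and start: "AE \<omega> in P. N 0 \<omega> = 0"
    and incr: "distr P (count_space UNIV) (\<lambda>\<omega>. N t \<omega> - N 0 \<omega>) =
      measure_pmf (poisson_law (LBINT u:{0..<t}. r u))"
    using assms unfolding nonhomogeneous_poisson_process_def by auto
  have "distr P (count_space UNIV) (N t) = distr P (count_space UNIV) (\<lambda>\<omega>. N t \<omega> - N 0 \<omega>)"
    by (rule distr_cong_AE) (use start in auto)
  with incr show ?thesis by simp
qed

text \<open>Each single value of \<Lambda> has probability 0, so the law of the process given
  \<Lambda> enters through a regular conditional probability \<open>P\<close>. The kernel identity
  in the conclusion is complemented by elementary conditioning on the events
  \<open>Y t \<omega> = y\<close> of positive probability.\<close>

theorem proposition6:
  fixes M :: "'a measure"
    and \<Lambda> :: "'a \<Rightarrow> real"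
    and Y :: "real \<Rightarrow> 'a \<Rightarrow> nat"
    and P :: "real \<Rightarrow> 'a measure"
    and f s :: "real \<Rightarrow> real"
    and \<alpha>\<^sub>0 \<beta>\<^sub>0 sbar t :: real
  assumes "prob_space M"
    and "\<alpha>\<^sub>0 > 0" and "\<beta>\<^sub>0 > 0" and "sbar > 0" and "t \<ge> 0"
    and f: "f \<in> {0..sbar} \<rightarrow> {0..}" "continuous_on {0..sbar} f" "mono_on {0..sbar} f" "f 0 = 0"
    and s: "s \<in> {0..<t} \<rightarrow> {0..sbar}" "set_borel_measurable lborel {0..<t} s"
    and Lambda: "\<Lambda> \<in> borel_measurable M" "distr M borel \<Lambda> = gamma_distribution \<alpha>\<^sub>0 \<beta>\<^sub>0"
    and Y: "\<And>u. u \<in> {0..t} \<Longrightarrow> Y u \<in> M \<rightarrow>\<^sub>M count_space UNIV"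
    and P: "regular_cond_distr M borel \<Lambda> M (\<lambda>\<omega>. \<omega>) P"
    and poisson: "\<And>l. l > 0 \<Longrightarrow>
      nonhomogeneous_poisson_process (P l) {0..t} Y (\<lambda>u. l * f (s u))"
  shows "regular_cond_distr M (count_space UNIV) (Y t) borel \<Lambda>
           (\<lambda>y. gamma_distribution (\<alpha>\<^sub>0 + real y) (\<beta>\<^sub>0 + (LBINT u:{0..<t}. f (s u)))) \<and>
         (\<forall>y. measure M {\<omega> \<in> space M. Y t \<omega> = y} > 0 \<longrightarrow>
           distr (uniform_measure M {\<omega> \<in> space M. Y t \<omega> = y}) borel \<Lambda> =
           gamma_distribution (\<alpha>\<^sub>0 + real y) (\<beta>\<^sub>0 + (LBINT u:{0..<t}. f (s u))))"
proof -
  interpret prob_space M by fact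
  define F where "F = (LBINT u:{0..<t}. f (s u))"
  define post where "post y = gamma_distribution (\<alpha>\<^sub>0 + real y) (\<beta>\<^sub>0 + F)" for y
  \<comment> \<open>This is the factor from \<open>poisson_gamma_conjugate\<close>; it turns out to
    be the marginal probability of \<open>Y t \<omega> = y\<close>.\<close>
  define c where "c y = \<beta>\<^sub>0 powr \<alpha>\<^sub>0 * F ^ y * Gamma (\<alpha>\<^sub>0 + real y) /
    (fact y * Gamma \<alpha>\<^sub>0 * (\<beta>\<^sub>0 + F) powr (\<alpha>\<^sub>0 + real y))" for y
  note [measurable] = Lambda(1)
  have Yt [measurable]: "Y t \<in> M \<rightarrow>\<^sub>M count_space UNIV"
    using Y \<open>t \<ge> 0\<close> by simp
  have "f (s u) \<ge> 0" if "u \<in> {0..<t}" for u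
    using f(1) s(1) that by blast
  hence "F \<ge> 0"
    unfolding F_def set_lebesgue_integral_def
    by (intro integral_nonneg_AE AE_I2) (auto simp: indicator_def)
  have "c y \<ge> 0" for y
    using \<open>\<alpha>\<^sub>0 > 0\<close> \<open>F \<ge> 0\<close> by (simp add: c_def Gamma_real_nonneg)
  have prob_post: "prob_space (post y)" for y
    unfolding post_def
    using \<open>\<alpha>\<^sub>0 > 0\<close> \<open>\<beta>\<^sub>0 > 0\<close> \<open>F \<ge> 0\<close> by (intro prob_space_gamma_distribution) auto
  have sets_post [simp]: "sets (post y) = sets borel" for y
    by (simp add: post_def sets_gamma_distribution)

  have P_meas: "P \<in> borel \<rightarrow>\<^sub>M prob_algebra M"
    and P_cond: "\<And>A B. A \<in> sets borel \<Longrightarrow> B \<in> sets M \<Longrightarrow>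
      emeasure M {\<omega> \<in> space M. \<Lambda> \<omega> \<in> A \<and> \<omega> \<in> B} =
      (\<integral>\<^sup>+x\<in>A. emeasure (P x) B \<partial>distr M borel \<Lambda>)"
    using P unfolding regular_cond_distr_def by auto
  have [measurable]: "(\<lambda>x. emeasure (P x) B) \<in> borel_measurable borel" if "B \<in> sets M" for B
    using P_meas that by (intro measurable_emeasure_kernel measurable_prob_algebraD)
  have sets_P: "sets (P x) = sets M" for x
    using measurable_space[OF P_meas, of x] by (simp add: space_prob_algebra)

  have likelihood: "emeasure (P x) {\<omega> \<in> space M. Y t \<omega> = y} = ennreal (pmf (poisson_law (x * F)) y)"
    if "x > 0" for x y
  proof -
    have "distr (P x) (count_space UNIV) (Y t) = measure_pmf (poisson_law (x * F))"
      using distr_nonhomogeneous_poisson_process[OF poisson[OF that] \<open>t \<ge> 0\<close>] by (simp add: F_def)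
    \<comment> \<open>Since \<open>P x\<close> has the same measurable sets as \<open>M\<close>,
      \<open>Y t\<close> is measurable for it and preimages may be taken in
      \<open>space M\<close>.\<close>
    moreover have "emeasure (distr (P x) (count_space UNIV) (Y t)) {y} =
        emeasure (P x) {\<omega> \<in> space M. Y t \<omega> = y}"
      using Yt sets_P[of x] sets_eq_imp_space_eq[OF sets_P[of x]]
      by (subst emeasure_distr)
         (auto cong: measurable_cong_sets intro!: arg_cong[where f = "emeasure (P x)"])
    ultimately show ?thesis
      by (simp add: emeasure_pmf_single)
  qed

  have joint: "emeasure M {\<omega> \<in> space M. Y t \<omega> = y \<and> \<Lambda> \<omega> \<in> A} = ennreal (c y) * emeasure (post y) A"
    if [measurable]: "A \<in> sets borel" for A y
  proof -
    \<comment> \<open>The event is rearranged so that \<Lambda> is the conditioning variable and the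
      event about \<open>Y t\<close> is measured by \<open>P x\<close>.\<close>
    have "emeasure M {\<omega> \<in> space M. Y t \<omega> = y \<and> \<Lambda> \<omega> \<in> A} =
        emeasure M {\<omega> \<in> space M. \<Lambda> \<omega> \<in> A \<and> \<omega> \<in> {\<omega> \<in> space M. Y t \<omega> = y}}"
      by (rule arg_cong[where f = "emeasure M"]) auto
    also have "\<dots> = (\<integral>\<^sup>+x\<in>A. emeasure (P x) {\<omega> \<in> space M. Y t \<omega> = y} \<partial>distr M borel \<Lambda>)"
      by (rule P_cond) measurable
    also have "\<dots> = (\<integral>\<^sup>+x. ennreal (gamma_density \<alpha>\<^sub>0 \<beta>\<^sub>0 x) *
        (emeasure (P x) {\<omega> \<in> space M. Y t \<omega> = y} * indicator A x) \<partial>lborel)"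
      unfolding Lambda(2) gamma_distribution_def by (subst nn_integral_density) auto
    also have "\<dots> = (\<integral>\<^sup>+x. ennreal (c y) *
        (ennreal (gamma_density (\<alpha>\<^sub>0 + real y) (\<beta>\<^sub>0 + F) x) * indicator A x) \<partial>lborel)"
    proof (rule nn_integral_cong)
      fix x
      \<comment> \<open>The likelihood is known only for x > 0; elsewhere both Gamma densities are
        0, whatever \<open>P x\<close> is.\<close>
      have "ennreal (gamma_density \<alpha>\<^sub>0 \<beta>\<^sub>0 x) * emeasure (P x) {\<omega> \<in> space M. Y t \<omega> = y} =
          ennreal (c y) * ennreal (gamma_density (\<alpha>\<^sub>0 + real y) (\<beta>\<^sub>0 + F) x)"
      proof (cases "x > 0")
        case True
        thus ?thesis
          using poisson_gamma_conjugate[OF \<open>\<alpha>\<^sub>0 > 0\<close> \<open>\<beta>\<^sub>0 > 0\<close> \<open>F \<ge> 0\<close>, of x y]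
            \<open>\<alpha>\<^sub>0 > 0\<close> \<open>c y \<ge> 0\<close>
          by (simp add: likelihood gamma_density_nonneg c_def flip: ennreal_mult)
      qed (simp add: gamma_density_def)
      thus "ennreal (gamma_density \<alpha>\<^sub>0 \<beta>\<^sub>0 x) *
          (emeasure (P x) {\<omega> \<in> space M. Y t \<omega> = y} * indicator A x) =
          ennreal (c y) *
          (ennreal (gamma_density (\<alpha>\<^sub>0 + real y) (\<beta>\<^sub>0 + F) x) * indicator A x)"
        by (simp flip: mult.assoc)
    qed
    also have "\<dots> = ennreal (c y) * emeasure (post y) A"
      by (simp add: nn_integral_cmult post_def gamma_distribution_def emeasure_density)
    finally show ?thesis .
  qed

  have marginal: "emeasure M {\<omega> \<in> space M. Y t \<omega> = y} = ennreal (c y)" for y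
    using joint[of UNIV y] prob_space.emeasure_space_1[OF prob_post[of y]]
    by (simp add: sets_eq_imp_space_eq[OF sets_post])

  \<comment> \<open>The atom condition is \<open>joint\<close> with its constant read as a
    probability by \<open>marginal\<close>.\<close>
  have "regular_cond_distr M (count_space UNIV) (Y t) borel \<Lambda> post"
    by (rule regular_cond_distr_countableI) (simp_all add: prob_post joint marginal)
  moreover have "distr (uniform_measure M {\<omega> \<in> space M. Y t \<omega> = y}) borel \<Lambda> = post y"
    if pos: "measure M {\<omega> \<in> space M. Y t \<omega> = y} > 0" for y
  proof (rule measure_eqI)
    fix A assume "A \<in> sets (distr (uniform_measure M {\<omega> \<in> space M. Y t \<omega> = y}) borel \<Lambda>)"
    hence [measurable]: "A \<in> sets borel" by simp
    \<comment> \<open>Positivity makes the division by \<open>c y\<close> in the elementary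
      conditional probability cancel the factor in \<open>joint\<close>.\<close>
    have "c y > 0"
      using pos marginal[of y] \<open>c y \<ge> 0\<close> by (simp add: measure_def)
    have "emeasure (distr (uniform_measure M {\<omega> \<in> space M. Y t \<omega> = y}) borel \<Lambda>) A =
        emeasure M ({\<omega> \<in> space M. Y t \<omega> = y} \<inter> (\<Lambda> -` A \<inter> space M)) / ennreal (c y)"
      by (simp add: emeasure_distr marginal)
    also have "{\<omega> \<in> space M. Y t \<omega> = y} \<inter> (\<Lambda> -` A \<inter> space M) =
        {\<omega> \<in> space M. Y t \<omega> = y \<and> \<Lambda> \<omega> \<in> A}"
      by auto
    also have "emeasure M \<dots> / ennreal (c y) = emeasure (post y) A"
      unfolding joint[OF \<open>A \<in> sets borel\<close>] using \<open>c y > 0\<close>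
      by (subst mult.commute) (simp add: ennreal_mult_divide_eq)
    finally show "emeasure (distr (uniform_measure M {\<omega> \<in> space M. Y t \<omega> = y}) borel \<Lambda>) A =
        emeasure (post y) A" .
  qed simp
  ultimately show ?thesis
    by (simp add: post_def[abs_def] F_def)
qed

end
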